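(* For each integer $m \geq 0$ there are constants $q_m$ and $r_m$ such that \[ c_m(n) \sim q_m \cdot r_m^n \qquad (n \to \infty), \] where \[ 1=r_0 < r_1 < r_2 < \cdots \qquad\text{and}\qquad \lim_{m \rightarrow \infty} r_m = 1+\sqrt{2}. \] The growth constant $r_m$ is the largest real root of the polynomial \[ a_m(x) = \alpha_+(x) \beta_+(x)^m + \alpha_-(x) \beta_-(x)^m, \] where \[ \alpha_\pm(x) = \pm \frac{x^4-2x^3-1}{2 \sqrt{(x^4-1)(x^2-2x-1)}} + \frac{1-x}2, \qquad \beta_\pm(x) = \frac{-x^3+x^2-x-1 \pm \sqrt{(x^4-1)(x^2-2x-1)}}{2}. \]
   Context: For an integer $m\ge 0$, the strip of height $m$ is $\{(x,y)\in\mathbb{Z}^2 : x\ge 0,\ 0\le y\le m\}$. A monotone path of length $n$ in the strip of height $m$ is a lattice path that starts at $(0,0)$, takes $n$ steps, each equal to $N=(0,1)$, $S=(0,-1)$ or $E=(1,0)$, never retraces steps (no step $N$ is immediately followed by $S$ and no $S$ immediately by $N$), and stays within the strip. $c_m(n)$ denotes the number of monotone paths of length $n$ in the strip of height $m$. The notation $f(n)\sim g(n)$ means $\lim_{n\to\infty} f(n)/g(n)=1$. In the formula for $a_m(x)$ the same value of the square root $\sqrt{(x^4-1)(x^2-2x-1)}$ is used in $\alpha_\pm$ and $\beta_\pm$ (the expression does not depend on which square root is chosen); the formula defines a polynomial in $x$ (valid for $x\notin\{\pm1,\pm i,1\pm\sqrt2\}$). *)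

theory Defs
  imports Complex_Main "HOL-Library.Product_Plus" "HOL-Computational_Algebra.Polynomial"
begin

datatype step = North | South | East

fun step_vec :: "step \<Rightarrow> int \<times> int" where
  "step_vec North = (0, 1)"
| "step_vec South = (0, -1)"
| "step_vec East = (1, 0)"

definition strip :: "nat \<Rightarrow> (int \<times> int) set" where
  "strip m = {(x, y). 0 \<le> x \<and> 0 \<le> y \<and> y \<le> int m}"

text \<open>A path starting at \<open>(0, 0)\<close> is encoded by its list of steps; \<open>path_vertex w k\<close> is the
  lattice point reached after the first \<open>k\<close> steps.\<close>

definition path_vertex :: "step list \<Rightarrow> nat \<Rightarrow> int \<times> int" where
  "path_vertex w k = sum_list (map step_vec (take k w))"

definition non_retracing :: "step list \<Rightarrow> bool" where
  "non_retracing w \<longleftrightarrow>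
     (\<forall>i. Suc i < length w \<longrightarrow>
        \<not> (w ! i = North \<and> w ! Suc i = South) \<and>
        \<not> (w ! i = South \<and> w ! Suc i = North))"

definition monotone_paths :: "nat \<Rightarrow> nat \<Rightarrow> step list set" where
  "monotone_paths m n =
     {w. length w = n \<and> non_retracing w \<and> (\<forall>k\<le>n. path_vertex w k \<in> strip m)}"

definition num_paths :: "nat \<Rightarrow> nat \<Rightarrow> nat" where
  "num_paths m n = card (monotone_paths m n)"

text \<open>\<open>monotone_paths m n\<close> is finite, so \<open>card\<close> is the actual number of paths.\<close>

lemma finite_monotone_paths: "finite (monotone_paths m n)"
proof -
  have "UNIV = {North, South, East}"
    using step.exhaust by auto
  then have "finite (UNIV :: step set)"
    by (metis finite.emptyI finite_insert)
  then have "finite {w :: step list. set w \<subseteq> UNIV \<and> length w = n}"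
    by (rule finite_lists_length_eq)
  then show ?thesis
    by (rule rev_finite_subset) (auto simp: monotone_paths_def)
qed

definition radicand :: "complex \<Rightarrow> complex" where
  "radicand x = (x^4 - 1) * (x^2 - 2*x - 1)"

text \<open>In the next four definitions \<open>s\<close> stands for the chosen value of the square root of
  \<open>radicand x\<close>.\<close>

definition alpha_plus :: "complex \<Rightarrow> complex \<Rightarrow> complex" where
  "alpha_plus s x = (x^4 - 2*x^3 - 1) / (2*s) + (1 - x) / 2"

definition alpha_minus :: "complex \<Rightarrow> complex \<Rightarrow> complex" where
  "alpha_minus s x = - ((x^4 - 2*x^3 - 1) / (2*s)) + (1 - x) / 2"

definition beta_plus :: "complex \<Rightarrow> complex \<Rightarrow> complex" where
  "beta_plus s x = (- (x^3) + x^2 - x - 1 + s) / 2"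

definition beta_minus :: "complex \<Rightarrow> complex \<Rightarrow> complex" where
  "beta_minus s x = (- (x^3) + x^2 - x - 1 - s) / 2"

text \<open>\<open>a_poly m\<close> is the polynomial given by the formula at every \<open>x\<close> that is not a root of the
  radicand, for either choice of the square root; it is well defined by \<open>a_poly_ex1\<close> below.\<close>

definition a_poly :: "nat \<Rightarrow> complex poly" where
  "a_poly m = (THE p. \<forall>x s. radicand x \<noteq> 0 \<longrightarrow> s^2 = radicand x \<longrightarrow>
     poly p x = alpha_plus s x * beta_plus s x ^ m + alpha_minus s x * beta_minus s x ^ m)"

lemma a_poly_exists:
  "\<exists>p. \<forall>x s. radicand x \<noteq> 0 \<longrightarrow> s^2 = radicand x \<longrightarrow>
     poly p x = alpha_plus s x * beta_plus s x ^ m + alpha_minus s x * beta_minus s x ^ m"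
proof (induction m rule: less_induct)
  case (less m)
  consider "m = 0" | "m = 1" | k where "m = Suc (Suc k)"
    by (metis One_nat_def not0_implies_Suc)
  then show ?case
  proof cases
    case 1
    show ?thesis
      by (rule exI[of _ "[:1, -1:]"]) (simp add: 1 alpha_plus_def alpha_minus_def field_simps)
  next
    case 2
    have "poly [:-1, 0, 1, -2, 1:] x
        = alpha_plus s x * beta_plus s x ^ m + alpha_minus s x * beta_minus s x ^ m"
      if "radicand x \<noteq> 0" "s^2 = radicand x" for x s
    proof -
      have s: "s \<noteq> 0" using that by auto
      have aux: "(A / (2*s) + B / 2) * ((t + s) / 2) + (- (A / (2*s)) + B / 2) * ((t - s) / 2)
          = A / 2 + B * t / 2" for A B t :: complex
        using s by (simp add: divide_simps) (simp add: algebra_simps)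
      have "alpha_plus s x * beta_plus s x + alpha_minus s x * beta_minus s x
          = (x^4 - 2*x^3 - 1) / 2 + (1 - x) * (- (x^3) + x^2 - x - 1) / 2"
        unfolding alpha_plus_def alpha_minus_def beta_plus_def beta_minus_def by (rule aux)
      also have "\<dots> = poly [:-1, 0, 1, -2, 1:] x"
        by (simp add: field_simps eval_nat_numeral)
      finally show ?thesis by (simp add: 2)
    qed
    then show ?thesis by blast
  next
    case (3 k)
    obtain p where p: "\<And>x s. radicand x \<noteq> 0 \<Longrightarrow> s^2 = radicand x \<Longrightarrow>
       poly p x = alpha_plus s x * beta_plus s x ^ k + alpha_minus s x * beta_minus s x ^ k"
      using less[of k] 3 by auto
    obtain q where q: "\<And>x s. radicand x \<noteq> 0 \<Longrightarrow> s^2 = radicand x \<Longrightarrow>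
       poly q x = alpha_plus s x * beta_plus s x ^ Suc k + alpha_minus s x * beta_minus s x ^ Suc k"
      using less[of "Suc k"] 3 by blast
    have "poly ([:-1, -1, 1, -1:] * q - [:0, 0, 0, 0, 1:] * p) x
        = alpha_plus s x * beta_plus s x ^ m + alpha_minus s x * beta_minus s x ^ m"
      if "radicand x \<noteq> 0" "s^2 = radicand x" for x s
    proof -
      define t where "t = - (x^3) + x^2 - x - 1"
      have "t^2 = radicand x + 4 * x^4"
        unfolding t_def radicand_def by algebra
      then have x4: "x^4 = (t * t - s * s) / 4"
        using that(2) by (simp add: power2_eq_square)
      have bp: "beta_plus s x = (t + s) / 2" and bm: "beta_minus s x = (t - s) / 2"
        by (simp_all add: beta_plus_def beta_minus_def t_def)
      have quad: "beta_plus s x * beta_plus s x = t * beta_plus s x - x^4"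
        "beta_minus s x * beta_minus s x = t * beta_minus s x - x^4"
        unfolding bp bm by (simp_all add: x4 field_simps)
      have rec: "b ^ m = t * b ^ Suc k - x^4 * b ^ k" if "b * b = t * b - x^4" for b
      proof -
        have "b ^ m = (b * b) * b ^ k" by (simp add: 3)
        also have "\<dots> = t * b ^ Suc k - x^4 * b ^ k" unfolding that by (simp add: algebra_simps)
        finally show ?thesis .
      qed
      have "poly ([:-1, -1, 1, -1:] * q - [:0, 0, 0, 0, 1:] * p) x = t * poly q x - x^4 * poly p x"
        by (simp add: t_def algebra_simps eval_nat_numeral)
      then show ?thesis
        unfolding rec[OF quad(1)] rec[OF quad(2)] p[OF that] q[OF that] by (simp add: algebra_simps)
    qed
    then show ?thesis by blast
  qed
qed

lemma a_poly_ex1: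
  "\<exists>!p. \<forall>x s. radicand x \<noteq> 0 \<longrightarrow> s^2 = radicand x \<longrightarrow>
     poly p x = alpha_plus s x * beta_plus s x ^ m + alpha_minus s x * beta_minus s x ^ m"
proof (rule ex_ex1I[OF a_poly_exists])
  fix p q :: "complex poly"
  assume p: "\<forall>x s. radicand x \<noteq> 0 \<longrightarrow> s^2 = radicand x \<longrightarrow>
     poly p x = alpha_plus s x * beta_plus s x ^ m + alpha_minus s x * beta_minus s x ^ m"
  assume q: "\<forall>x s. radicand x \<noteq> 0 \<longrightarrow> s^2 = radicand x \<longrightarrow>
     poly q x = alpha_plus s x * beta_plus s x ^ m + alpha_minus s x * beta_minus s x ^ m"
  define d :: "complex poly" where "d = [:-1, 0, 0, 0, 1:] * [:-1, -2, 1:]"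
  have d: "poly d x = radicand x" for x
    unfolding d_def radicand_def by (simp add: algebra_simps eval_nat_numeral)
  have "poly ((p - q) * d) x = 0" for x
  proof (cases "radicand x = 0")
    case False
    have "poly p x = poly q x"
      using False p[rule_format, of x "csqrt (radicand x)"] q[rule_format, of x "csqrt (radicand x)"]
      by simp
    then show ?thesis by simp
  qed (simp add: d)
  then have "(p - q) * d = 0"
    using poly_all_0_iff_0 by blast
  moreover have "d \<noteq> 0" by (simp add: d_def)
  ultimately show "p = q" by simp
qed

definition is_largest_real_root :: "complex poly \<Rightarrow> real \<Rightarrow> bool" where
  "is_largest_real_root p r \<longleftrightarrow>
     poly p (complex_of_real r) = 0 \<and>
     (\<forall>y::real. poly p (complex_of_real y) = 0 \<longrightarrow> y \<le> r)"

end

theory Submission imports Defs begin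

text \<open>
  A path is a walk on the pairs (last step, current height), so its counting sequence is governed by a
  nonnegative matrix \<open>A\<close>. A positive eigenvector \<open>v\<close> with eigenvalue \<open>r\<close> turns \<open>A\<close> into the stochastic
  matrix \<open>A i j * v j / (r * v i)\<close>, whose powers contract oscillations (Doeblin), and this yields
  \<open>c n \<sim> q * r ^ n\<close>. On the states whose last step is East, the eigenvector satisfies
  a three-term recurrence in the height, with the same coefficients as the recurrence in \<open>m\<close> of the
  polynomials \<open>a_m\<close>; its upper boundary condition is \<open>a_m(r) = 0\<close>, and it is positive as soon as
  \<open>r\<close> exceeds all real roots of the earlier polynomials. That recurrence also makes the
  largest real roots increase: with signs normalised, the polynomial with index \<open>m + 2\<close> is negative
  at the largest root of its predecessor. The roots stay below \<open>1 + sqrt 2\<close>, where the discriminant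
  \<open>(x^4 - 1) * (x^2 - 2 * x - 1)\<close> changes sign; on the interval \<open>(1, 1 + sqrt 2)\<close> it is negative, so the
  sequence oscillates and the roots cannot accumulate earlier.
\<close>

section \<open>Averaging iterations and walk counts\<close>


lemma weighted_average_ge:
  fixes p x :: "'a \<Rightarrow> real"
  assumes "finite S" "\<And>l. l \<in> S \<Longrightarrow> 0 \<le> p l" "sum p S = 1"
    and "\<And>l. l \<in> S \<Longrightarrow> c \<le> x l" "j \<in> S"
  shows "c + p j * (x j - c) \<le> (\<Sum>l\<in>S. p l * x l)"
proof -
  have "p j * (x j - c) \<le> (\<Sum>l\<in>S. p l * (x l - c))"
    using assms by (intro member_le_sum) auto
  also have "\<dots> = (\<Sum>l\<in>S. p l * x l) - sum p S * c"
    by (simp add: right_diff_distrib sum_subtractf sum_distrib_right)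
  finally show ?thesis
    using assms(3) by simp
qed

lemma weighted_average_le:
  fixes p x :: "'a \<Rightarrow> real"
  assumes "finite S" "\<And>l. l \<in> S \<Longrightarrow> 0 \<le> p l" "sum p S = 1"
    and "\<And>l. l \<in> S \<Longrightarrow> x l \<le> d" "j \<in> S"
  shows "(\<Sum>l\<in>S. p l * x l) \<le> d - p j * (d - x j)"
  using weighted_average_ge[of S p "- d" "\<lambda>l. - x l" j] assms
  by (simp add: sum_negf algebra_simps)

text \<open>Averaging raises minima and lowers maxima. Padded by loops at \<open>z\<close>, all
  walks to \<open>z\<close> get a common length \<open>N\<close>; after \<open>N\<close> steps every
  state puts weight at least \<open>\<delta>\<close> on \<open>z\<close>, so the oscillation shrinks
  by the factor \<open>1 - \<delta>\<close>.\<close>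

lemma iterated_average_converges:
  fixes P :: "'a \<Rightarrow> 'a \<Rightarrow> real" and g :: "nat \<Rightarrow> 'a \<Rightarrow> real"
  assumes fin: "finite S"
    and P_nonneg: "\<And>i j. i \<in> S \<Longrightarrow> j \<in> S \<Longrightarrow> 0 \<le> P i j"
    and P_sum: "\<And>i. i \<in> S \<Longrightarrow> (\<Sum>j\<in>S. P i j) = 1"
    and g_Suc: "\<And>n i. i \<in> S \<Longrightarrow> g (Suc n) i = (\<Sum>j\<in>S. P i j * g n j)"
    and z: "z \<in> S" "0 < P z z"
    and reach: "\<And>i. i \<in> S \<Longrightarrow> (i, z) \<in> {(i, j). i \<in> S \<and> j \<in> S \<and> 0 < P i j}\<^sup>*"
    and low: "\<And>i. i \<in> S \<Longrightarrow> a \<le> g 0 i"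
  shows "\<exists>L\<ge>a. \<forall>i\<in>S. (\<lambda>n. g n i) \<longlonglongrightarrow> L"
proof -
  define bdd where "bdd n c d \<longleftrightarrow> (\<forall>j\<in>S. c \<le> g n j \<and> g n j \<le> d)" for n c d
  have step: "c + P i j * (g n j - c) \<le> g (Suc n) i"
    "g (Suc n) i \<le> d - P i j * (d - g n j)" if "bdd n c d" "i \<in> S" "j \<in> S" for n c d i j
    using that weighted_average_ge[of S "P i" c "g n" j] weighted_average_le[of S "P i" "g n" d j]
    by (auto simp: bdd_def fin P_nonneg P_sum g_Suc)
  have bdd_Suc: "bdd (Suc n) c d" if "bdd n c d" for n c d
    unfolding bdd_def
  proof
    fix i assume i: "i \<in> S"
    have "0 \<le> P i z * (g n z - c)" "0 \<le> P i z * (d - g n z)"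
      using that i z P_nonneg by (auto simp: bdd_def)
    then show "c \<le> g (Suc n) i \<and> g (Suc n) i \<le> d"
      using step[OF that i z(1)] by linarith
  qed
  have bdd_add: "bdd (n + k) c d" if "bdd n c d" for n k c d
    using that by (induction k) (auto simp: bdd_Suc)
  \<comment> \<open>After \<open>k\<close> steps the value at \<open>i\<close> still feels the value at \<open>z\<close> with weight at least \<open>\<delta>\<close>.\<close>
  define squeeze where "squeeze k \<delta> i \<longleftrightarrow> (\<forall>n c d. bdd n c d \<longrightarrow>
    c + \<delta> * (g n z - c) \<le> g (n + k) i \<and> g (n + k) i \<le> d - \<delta> * (d - g n z))" for k \<delta> i
  have squeeze_back: "squeeze (Suc k) (P i j * \<delta>) i"
    if "squeeze k \<delta> j" "i \<in> S" "j \<in> S" for k \<delta> i j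
    unfolding squeeze_def
  proof (intro allI impI)
    fix n c d assume b: "bdd n c d"
    have "P i j * (\<delta> * (g n z - c)) \<le> P i j * (g (n + k) j - c)"
         "P i j * (\<delta> * (d - g n z)) \<le> P i j * (d - g (n + k) j)"
      using that(1) b P_nonneg[OF that(2,3)] unfolding squeeze_def
      by (force intro!: mult_left_mono)+
    then show "c + P i j * \<delta> * (g n z - c) \<le> g (n + Suc k) i \<and>
        g (n + Suc k) i \<le> d - P i j * \<delta> * (d - g n z)"
      using step[OF bdd_add[OF b, of k] that(2,3)] by (auto simp: mult.assoc)
  qed
  \<comment> \<open>The value at \<open>z\<close> keeps weight \<open>P z z\<close> on its own
    previous value, so one loop at \<open>z\<close> lengthens the walk.\<close>
  have squeeze_wait: "squeeze (Suc k) (\<delta> * P z z) i" if "squeeze k \<delta> i" "0 < \<delta>" for k \<delta> i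
    unfolding squeeze_def
  proof (intro allI impI)
    fix n c d assume b: "bdd n c d"
    have "\<delta> * (P z z * (g n z - c)) \<le> \<delta> * (g (Suc n) z - c)"
         "\<delta> * (P z z * (d - g n z)) \<le> \<delta> * (d - g (Suc n) z)"
      using step[OF b z(1) z(1)] that(2) by (force intro!: mult_left_mono)+
    moreover have "c + \<delta> * (g (Suc n) z - c) \<le> g (Suc n + k) i"
      "g (Suc n + k) i \<le> d - \<delta> * (d - g (Suc n) z)"
      using that(1) bdd_Suc[OF b] unfolding squeeze_def by blast+
    ultimately show "c + \<delta> * P z z * (g n z - c) \<le> g (n + Suc k) i \<and>
        g (n + Suc k) i \<le> d - \<delta> * P z z * (d - g n z)"
      by (auto simp: mult.assoc)
  qed
  have squeeze_mono: "squeeze k \<delta>' i" if "squeeze k \<delta> i" "\<delta>' \<le> \<delta>" for k \<delta> \<delta>' i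
    unfolding squeeze_def
  proof (intro allI impI)
    fix n c d assume b: "bdd n c d"
    have "\<delta>' * (g n z - c) \<le> \<delta> * (g n z - c)" "\<delta>' * (d - g n z) \<le> \<delta> * (d - g n z)"
      using b z that(2) by (auto intro!: mult_right_mono simp: bdd_def)
    moreover have "c + \<delta> * (g n z - c) \<le> g (n + k) i" "g (n + k) i \<le> d - \<delta> * (d - g n z)"
      using that(1) b unfolding squeeze_def by blast+
    ultimately show "c + \<delta>' * (g n z - c) \<le> g (n + k) i \<and> g (n + k) i \<le> d - \<delta>' * (d - g n z)"
      by linarith
  qed
  have "\<exists>k. \<exists>\<delta>>0. squeeze k \<delta> i" if "i \<in> S" for i
    using reach[OF that]
  proof (induction rule: converse_rtrancl_induct)
    case base
    have "squeeze 0 1 z" by (auto simp: squeeze_def)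
    then show ?case using zero_less_one by blast
  next
    case (step i j)
    then show ?case using squeeze_back by (metis (lifting) case_prodD mem_Collect_eq mult_pos_pos)
  qed
  then obtain k where k: "\<And>i. i \<in> S \<Longrightarrow> \<exists>\<delta>>0. squeeze (k i) \<delta> i"
    by metis
  define N where "N = Max (k ` S)"
  have "\<exists>\<delta>>0. squeeze (k i + l) \<delta> i" if "i \<in> S" for i l
    by (induction l) (use k[OF that] squeeze_wait z(2) in \<open>auto, metis mult_pos_pos\<close>)
  moreover have "N = k i + (N - k i)" if "i \<in> S" for i
    using fin that by (simp add: N_def)
  ultimately have "\<exists>\<delta>>0. squeeze N \<delta> i" if "i \<in> S" for i
    using that by metis
  then obtain \<delta>f where \<delta>f: "\<And>i. i \<in> S \<Longrightarrow> 0 < \<delta>f i" "\<And>i. i \<in> S \<Longrightarrow> squeeze N (\<delta>f i) i"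
    by metis
  define \<delta> where "\<delta> = Min (\<delta>f ` S)"
  have \<delta>: "0 < \<delta>" using fin z \<delta>f(1) by (subst \<delta>_def, subst Min_gr_iff) auto
  have sq: "squeeze N \<delta> i" if "i \<in> S" for i
    using squeeze_mono[OF \<delta>f(2)[OF that], of \<delta>] fin that by (auto simp: \<delta>_def)
  define lo where "lo n = Min (g n ` S)" for n
  define hi where "hi n = Max (g n ` S)" for n
  have bdd: "bdd n (lo n) (hi n)" for n
    using fin by (auto simp: bdd_def lo_def hi_def)
  have lo_ge: "c \<le> lo n" and hi_le: "hi n \<le> d" if "bdd n c d" for n c d
    using fin z that by (auto simp: bdd_def lo_def hi_def intro!: Min.boundedI Max.boundedI)
  have lo_mono: "incseq lo" and hi_mono: "decseq hi"
    using lo_ge[OF bdd_Suc[OF bdd]] hi_le[OF bdd_Suc[OF bdd]]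
    by (auto intro!: incseq_SucI decseq_SucI)
  have lo_hi: "lo n \<le> hi n" for n
    using bdd[of n] z by (force simp: bdd_def)
  have "lo n \<le> hi 0" for n
    using lo_hi[of n] decseqD[OF hi_mono, of 0 n] by simp
  then obtain L where L: "lo \<longlonglongrightarrow> L" "\<And>n. lo n \<le> L"
    using incseq_convergent[OF lo_mono, of "hi 0"] by blast
  have "lo 0 \<le> hi n" for n
    using lo_hi[of n] incseqD[OF lo_mono, of 0 n] by simp
  then obtain H where H: "hi \<longlonglongrightarrow> H" "\<And>n. H \<le> hi n"
    using decseq_convergent[OF hi_mono, of "lo 0"] by blast
  \<comment> \<open>The value at \<open>z\<close> cancels in the difference of the two squeezed
    bounds.\<close>
  have contract: "hi (n + N) - lo (n + N) \<le> (1 - \<delta>) * (hi n - lo n)" for n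
  proof -
    have "bdd (n + N) (lo n + \<delta> * (g n z - lo n)) (hi n - \<delta> * (hi n - g n z))"
      using sq bdd[of n] unfolding squeeze_def bdd_def[of "n + N"] by blast
    from lo_ge[OF this] hi_le[OF this] show ?thesis by (simp add: algebra_simps)
  qed
  have "H - L \<le> (1 - \<delta>) * (H - L)"
  proof (rule LIMSEQ_le)
    show "(\<lambda>n. hi (n + N) - lo (n + N)) \<longlonglongrightarrow> H - L"
      using H(1) L(1) by (intro tendsto_diff LIMSEQ_ignore_initial_segment)
    show "(\<lambda>n. (1 - \<delta>) * (hi n - lo n)) \<longlonglongrightarrow> (1 - \<delta>) * (H - L)"
      using H(1) L(1) by (intro tendsto_intros)
  qed (use contract in auto)
  then have "\<delta> * (H - L) \<le> 0" by (simp add: algebra_simps)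
  then have "H \<le> L" using \<delta> by (simp add: mult_le_0_iff)
  moreover have "L \<le> H" using L(1) H(1) lo_hi by (intro LIMSEQ_le[OF L(1) H(1)]) auto
  ultimately have hiL: "hi \<longlonglongrightarrow> L" using H by simp
  have "(\<lambda>n. g n i) \<longlonglongrightarrow> L" if "i \<in> S" for i
    by (rule tendsto_sandwich[OF _ _ L(1) hiL]) (use bdd that in \<open>auto simp: bdd_def\<close>)
  moreover have "a \<le> lo 0"
    using low fin z by (auto simp: lo_def intro!: Min.boundedI)
  then have "a \<le> L" using L(2)[of 0] by simp
  ultimately show ?thesis by blast
qed

text \<open>Division by \<open>r ^ n * v i\<close> turns the counting recurrence into averaging by
  the stochastic matrix \<open>P\<close>. The positive minimum of \<open>g 0\<close> bounds the
  limit below, hence \<open>L > 0\<close>. All states must reach \<open>z\<close>, but not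
  conversely, which leaves room for states without predecessors.\<close>

lemma walk_count_asymptotics:
  fixes succ :: "'a \<Rightarrow> 'a set" and f :: "nat \<Rightarrow> 'a \<Rightarrow> real"
  assumes fin: "finite S" and succ: "\<And>i. i \<in> S \<Longrightarrow> succ i \<subseteq> S"
    and v: "\<And>i. i \<in> S \<Longrightarrow> 0 < v i" and r: "0 < r"
    and eigen: "\<And>i. i \<in> S \<Longrightarrow> (\<Sum>j\<in>succ i. v j) = r * v i"
    and f_0: "\<And>i. i \<in> S \<Longrightarrow> 0 < f 0 i"
    and f_Suc: "\<And>n i. i \<in> S \<Longrightarrow> f (Suc n) i = (\<Sum>j\<in>succ i. f n j)"
    and z: "z \<in> S" "z \<in> succ z"
    and reach: "\<And>i. i \<in> S \<Longrightarrow> (i, z) \<in> {(i, j). i \<in> S \<and> j \<in> succ i}\<^sup>*"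
  shows "\<exists>L>0. \<forall>i\<in>S. (\<lambda>n. f n i / r ^ n) \<longlonglongrightarrow> L * v i"
proof -
  define P where "P i j = (if j \<in> succ i then v j / (r * v i) else 0)" for i j
  define g where "g n i = f n i / (r ^ n * v i)" for n i
  have sum_S: "(\<Sum>j\<in>S. P i j * x j) = (\<Sum>j\<in>succ i. v j * x j) / (r * v i)" if "i \<in> S" for i x
  proof -
    have "(\<Sum>j\<in>S. P i j * x j) = (\<Sum>j\<in>succ i. P i j * x j)"
      by (rule sum.mono_neutral_right[OF fin succ[OF that]]) (auto simp: P_def)
    then show ?thesis by (simp add: P_def sum_divide_distrib)
  qed
  define a where "a = Min (g 0 ` S)"
  have rel: "{(i, j). i \<in> S \<and> j \<in> succ i} = {(i, j). i \<in> S \<and> j \<in> S \<and> 0 < P i j}"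
    using succ v r by (fastforce simp: P_def split: if_splits)
  have "\<exists>L\<ge>a. \<forall>i\<in>S. (\<lambda>n. g n i) \<longlonglongrightarrow> L"
  proof (rule iterated_average_converges[where P = P and z = z])
    show "(\<Sum>j\<in>S. P i j) = 1" if "i \<in> S" for i
      using sum_S[OF that, of "\<lambda>_. 1"] eigen[OF that] v[OF that] r by simp
    show "g (Suc n) i = (\<Sum>j\<in>S. P i j * g n j)" if i: "i \<in> S" for n i
    proof -
      have "(\<Sum>j\<in>succ i. v j * g n j) = (\<Sum>j\<in>succ i. f n j / r ^ n)"
        by (rule sum.cong) (use succ[OF i] v in \<open>force simp: g_def\<close>)+
      then show ?thesis
        unfolding sum_S[OF i] using f_Suc[OF i] by (simp add: g_def sum_divide_distrib mult_ac)
    qed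
    show "0 \<le> P i j" if "i \<in> S" "j \<in> S" for i j
      using v that r by (auto simp: P_def intro!: divide_nonneg_pos less_imp_le)
    show "0 < P z z" using z v[OF z(1)] r by (simp add: P_def)
    show "a \<le> g 0 i" if "i \<in> S" for i using that fin by (auto simp: a_def)
  qed (use fin z reach rel in auto)
  then obtain L where L: "a \<le> L" "\<And>i. i \<in> S \<Longrightarrow> (\<lambda>n. g n i) \<longlonglongrightarrow> L" by blast
  have "0 < a" unfolding a_def using fin z v f_0 by (subst Min_gr_iff) (auto simp: g_def)
  moreover have "(\<lambda>n. f n i / r ^ n) \<longlonglongrightarrow> L * v i" if "i \<in> S" for i
    using tendsto_mult_right[OF L(2)[OF that], of "v i"] v[OF that] by (simp add: g_def)
  ultimately show ?thesis using L(1) by (intro exI[of _ L]) auto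
qed

section \<open>The polynomials and their largest real roots\<close>


text \<open>\<open>strip_poly m\<close> is \<open>(-1) ^ Suc m * a_m\<close>, which has leading coefficient 1. It is defined over an
  arbitrary ring so that the real polynomial and its complex counterpart are the same constant.\<close>

fun strip_poly :: "nat \<Rightarrow> 'a::comm_ring_1 poly" where
  "strip_poly 0 = [:-1, 1:]"
| "strip_poly (Suc 0) = [:-1, 0, 1, -2, 1:]"
| "strip_poly (Suc (Suc k)) = [:1, 1, -1, 1:] * strip_poly (Suc k) - [:0, 0, 0, 0, 1:] * strip_poly k"

text \<open>\<open>- bulk x\<close> and \<open>x^4\<close> are the sum and the product of \<open>\<beta>\<^sub>+\<close> and \<open>\<beta>\<^sub>-\<close>.\<close>

definition bulk :: "'a::comm_ring_1 \<Rightarrow> 'a" where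
  "bulk x = x^3 - x^2 + x + 1"

lemma poly_strip_poly_0: "poly (strip_poly 0) x = x - 1"
  by simp

lemma poly_strip_poly_1: "poly (strip_poly (Suc 0)) x = x^4 - 2 * x^3 + x^2 - 1"
  by (simp add: algebra_simps eval_nat_numeral)

lemma poly_strip_poly_Suc_Suc:
  "poly (strip_poly (Suc (Suc k))) x =
     bulk x * poly (strip_poly (Suc k)) x - x^4 * poly (strip_poly k) x"
  by (simp add: bulk_def algebra_simps eval_nat_numeral)

lemmas poly_strip_poly = poly_strip_poly_0 poly_strip_poly_1 poly_strip_poly_Suc_Suc

declare strip_poly.simps [simp del]

lemma poly_strip_poly_of_real:
  "poly (strip_poly k) (of_real y :: complex) = of_real (poly (strip_poly k) y)"
  by (induction k rule: strip_poly.induct) (simp_all add: poly_strip_poly bulk_def)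

text \<open>Both values of \<beta> are roots of \<open>b^2 + bulk x * b + x^4\<close>, so
  combinations of their powers obey a three-term recurrence; the sign \<open>(-1) ^ Suc m\<close>
  absorbs the minus in front of \<open>bulk x\<close>.\<close>

lemma alpha_beta_eq_strip_poly:
  assumes "radicand x \<noteq> 0" "s^2 = radicand x"
  shows "alpha_plus s x * beta_plus s x ^ m + alpha_minus s x * beta_minus s x ^ m
    = (-1) ^ Suc m * poly (strip_poly m) x"
proof (induction m rule: strip_poly.induct)
  case 1
  show ?case by (simp add: poly_strip_poly alpha_plus_def alpha_minus_def field_simps)
next
  case 2
  have "s \<noteq> 0" using assms by auto
  then have "(A / (2*s) + B / 2) * ((t + s) / 2) + (- (A / (2*s)) + B / 2) * ((t - s) / 2)
      = (A + B * t) / 2" for A B t :: complex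
    by (simp add: divide_simps) (simp add: algebra_simps)
  then have "alpha_plus s x * beta_plus s x + alpha_minus s x * beta_minus s x
      = (x^4 - 2*x^3 - 1 + (1 - x) * (- (x^3) + x^2 - x - 1)) / 2"
    unfolding alpha_plus_def alpha_minus_def beta_plus_def beta_minus_def by blast
  also have "\<dots> = (-1) ^ Suc (Suc 0) * poly (strip_poly (Suc 0)) x"
    unfolding poly_strip_poly_1 by (simp add: field_simps eval_nat_numeral)
  finally show ?case by simp
next
  case (3 k)
  have disc: "s^2 = bulk x ^ 2 - 4 * x^4"
    using assms(2) by (simp add: radicand_def bulk_def algebra_simps eval_nat_numeral)
  have root: "b * b = - bulk x * b - x^4" if "b = beta_plus s x \<or> b = beta_minus s x" for b
  proof -
    have "2 * b + bulk x = s \<or> 2 * b + bulk x = - s"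
      using that unfolding beta_plus_def beta_minus_def bulk_def
      by (elim disjE) (simp_all add: field_simps)
    then have "(2 * b + bulk x)^2 = s^2" by (metis power2_minus)
    then have "4 * (b * b) = 4 * (- bulk x * b - x^4)" unfolding disc by algebra
    then show ?thesis by (metis mult_left_cancel zero_neq_numeral)
  qed
  have "b ^ Suc (Suc k) = - bulk x * b ^ Suc k - x^4 * b ^ k"
    if "b = beta_plus s x \<or> b = beta_minus s x" for b
  proof -
    have "b ^ Suc (Suc k) = (b * b) * b ^ k" by simp
    then show ?thesis unfolding root[OF that] by (simp add: algebra_simps)
  qed
  then have "alpha_plus s x * beta_plus s x ^ Suc (Suc k) + alpha_minus s x * beta_minus s x ^ Suc (Suc k)
    = - bulk x * (alpha_plus s x * beta_plus s x ^ Suc k + alpha_minus s x * beta_minus s x ^ Suc k)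
      - x^4 * (alpha_plus s x * beta_plus s x ^ k + alpha_minus s x * beta_minus s x ^ k)"
    by (simp only: simp_thms) (simp only: algebra_simps)
  then show ?case
    unfolding "3.IH" by (simp add: poly_strip_poly algebra_simps)
qed

lemma a_poly_eq: "a_poly m = smult ((-1) ^ Suc m) (strip_poly m)"
  unfolding a_poly_def
  by (rule the1_equality[OF a_poly_ex1]) (simp add: alpha_beta_eq_strip_poly)

section \<open>Existence, increase and limit of the largest roots\<close>

definition dominant_root :: "nat \<Rightarrow> real \<Rightarrow> bool" where
  "dominant_root k r \<longleftrightarrow> poly (strip_poly k) r = 0 \<and> (\<forall>x>r. 0 < poly (strip_poly k) x)"

lemma dominant_root_unique: "dominant_root k r \<Longrightarrow> dominant_root k r' \<Longrightarrow> r = r'"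
  by (metis dominant_root_def less_irrefl linorder_neqE)

lemma is_largest_real_root_a_poly:
  assumes "dominant_root k r"
  shows "is_largest_real_root (a_poly k) r"
proof -
  have "poly (a_poly k) (complex_of_real y) = 0 \<longleftrightarrow> poly (strip_poly k) y = 0" for y
    by (simp add: a_poly_eq poly_strip_poly_of_real)
  then show ?thesis
    using assms unfolding is_largest_real_root_def dominant_root_def
    by (metis less_irrefl not_le)
qed

text \<open>The sign change yields a root beyond \<open>a\<close>, and there are finitely many. A
  negative value beyond the largest one would force a further root before \<open>b\<close>.\<close>

lemma last_sign_change_poly:
  fixes p :: "real poly"
  assumes "poly p a < 0" and pos: "\<And>x. b \<le> x \<Longrightarrow> 0 < poly p x"
  shows "\<exists>r>a. poly p r = 0 \<and> (\<forall>x>r. 0 < poly p x)"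
proof -
  define Z where "Z = {x. poly p x = 0 \<and> a < x}"
  have "p \<noteq> 0" using assms(1) by auto
  then have fin: "finite Z"
    unfolding Z_def by (intro finite_subset[OF _ poly_roots_finite[of p]]) auto
  have "a < b" using assms(1) pos[of a] by force
  then have ne: "Z \<noteq> {}"
    using poly_IVT_pos[of a b p] assms by (auto simp: Z_def)
  define r where "r = Max Z"
  have r: "r \<in> Z" using fin ne by (simp add: r_def)
  have "0 < poly p x" if "r < x" for x
  proof (rule ccontr)
    assume "\<not> 0 < poly p x"
    moreover have *: "poly p y \<noteq> 0" if "r < y" for y
    proof
      assume "poly p y = 0"
      then have "y \<in> Z" using that r by (auto simp: Z_def)
      then show False using Max_ge[OF fin] that by (force simp: r_def)
    qed
    ultimately have "poly p x < 0" using that by (metis linorder_neqE)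
    moreover have "x < b" using pos[of x] calculation by force
    ultimately obtain y where "x < y" "poly p y = 0"
      using poly_IVT_pos[of x b p] pos[of b] by auto
    then show False using *[of y] that by force
  qed
  then show ?thesis using r by (auto simp: Z_def)
qed

lemma silver_ratio_quadratic:
  fixes x :: real
  assumes "1 + sqrt 2 \<le> x"
  shows "0 \<le> x^2 - 2 * x - 1"
proof -
  have "sqrt 2 ^ 2 \<le> (x - 1) ^ 2"
    using assms by (intro power_mono) auto
  then show ?thesis by (simp add: power2_eq_square algebra_simps)
qed

text \<open>The induction also carries that consecutive values grow by a factor of at least
  \<open>x^2\<close>. This bound persists because \<open>bulk x \<ge> 2 * x^2\<close> from
  \<open>1 + sqrt 2\<close> onwards.\<close>

lemma strip_poly_pos_beyond_silver_ratio:
  fixes x :: real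
  assumes "1 + sqrt 2 \<le> x"
  shows "0 < poly (strip_poly k) x"
proof -
  have x: "1 < x" using assms by (smt (verit) real_sqrt_gt_zero)
  have q: "0 \<le> x^2 - 2 * x - 1" by (rule silver_ratio_quadratic[OF assms])
  have "0 < poly (strip_poly k) x \<and> x^2 * poly (strip_poly k) x \<le> poly (strip_poly (Suc k)) x"
  proof (induction k)
    case 0
    have "0 \<le> (x^2 - 2*x - 1) * (x^2 - x + 1)"
    proof (intro mult_nonneg_nonneg q)
      have "x^2 - x + 1 = x * (x - 1) + 1" by (simp add: power2_eq_square algebra_simps)
      then show "0 \<le> x^2 - x + 1" using x by simp
    qed
    moreover have "x^4 - 2 * x^3 + x^2 - 1 - x^2 * (x - 1) = (x^2 - 2*x - 1) * (x^2 - x + 1) + x"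
      by (simp add: algebra_simps eval_nat_numeral)
    ultimately show ?case using x by (simp add: poly_strip_poly)
  next
    case (Suc k)
    have pos: "0 < poly (strip_poly (Suc k)) x"
      using Suc x by (smt (verit) mult_pos_pos zero_less_power)
    have "bulk x - 2 * x^2 = (x - 1) * (x^2 - 2*x - 1)"
      by (simp add: bulk_def algebra_simps eval_nat_numeral)
    then have "0 \<le> (bulk x - 2 * x^2) * poly (strip_poly (Suc k)) x"
      using pos q x by simp
    moreover have "0 \<le> x^2 * (poly (strip_poly (Suc k)) x - x^2 * poly (strip_poly k) x)"
      using Suc by simp
    moreover have "poly (strip_poly (Suc (Suc k))) x - x^2 * poly (strip_poly (Suc k)) x
        = (bulk x - 2 * x^2) * poly (strip_poly (Suc k)) x
          + x^2 * (poly (strip_poly (Suc k)) x - x^2 * poly (strip_poly k) x)"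
      by (simp add: poly_strip_poly algebra_simps eval_nat_numeral)
    ultimately show ?case using pos by linarith
  qed
  then show ?thesis ..
qed

lemma dominant_root_0: "dominant_root 0 1"
  by (simp add: dominant_root_def poly_strip_poly)

text \<open>At \<open>r'\<close> the recurrence leaves only
  \<open>- r'^4 * poly (strip_poly k) r'\<close>, which is negative since \<open>r'\<close> lies
  beyond \<open>r\<close>. This sign needs two neighbouring roots in the induction.\<close>

lemma dominant_roots_increasing:
  "\<exists>r r'. 1 \<le> r \<and> r < r' \<and> dominant_root k r \<and> dominant_root (Suc k) r'"
proof (induction k)
  case 0
  have "poly (strip_poly (Suc 0)) (1::real) < 0" by (simp add: poly_strip_poly)
  then have "\<exists>r>1. dominant_root (Suc 0) r"
    unfolding dominant_root_def
    by (rule last_sign_change_poly) (rule strip_poly_pos_beyond_silver_ratio)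
  with dominant_root_0 show ?case by auto
next
  case (Suc k)
  then obtain r r' where r: "1 \<le> r" "r < r'" "dominant_root k r" "dominant_root (Suc k) r'" by blast
  then have "0 < r'^4 * poly (strip_poly k) r'" by (simp add: dominant_root_def)
  then have "poly (strip_poly (Suc (Suc k))) r' < 0"
    using r(4) by (simp add: poly_strip_poly dominant_root_def)
  then have "\<exists>r>r'. dominant_root (Suc (Suc k)) r"
    unfolding dominant_root_def
    by (rule last_sign_change_poly) (rule strip_poly_pos_beyond_silver_ratio)
  moreover have "1 \<le> r'" using r by simp
  ultimately show ?case using r(4) by blast
qed

text \<open>If all values were positive, their ratios \<open>\<rho> k\<close> would drop by at least
  \<open>\<epsilon>\<close> at each step and finally become negative.\<close>

lemma strip_poly_not_always_pos:
  fixes x :: real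
  assumes "1 < x" "x < 1 + sqrt 2"
  shows "\<exists>k. poly (strip_poly k) x \<le> 0"
proof (rule ccontr)
  assume "\<nexists>k. poly (strip_poly k) x \<le> 0"
  then have pos: "0 < poly (strip_poly k) x" for k by (meson not_le)
  define \<rho> where "\<rho> k = poly (strip_poly (Suc k)) x / poly (strip_poly k) x" for k
  have \<rho>: "0 < \<rho> k" for k using pos by (simp add: \<rho>_def)
  \<comment> \<open>This is \<open>(x - 1) * (1 + 2*x - x^2)\<close>, positive between 1 and
    \<open>1 + sqrt 2\<close>.\<close>
  define \<epsilon> where "\<epsilon> = 2 * x^2 - bulk x"
  have "(x - 1) ^ 2 < sqrt 2 ^ 2"
    using assms by (intro power_strict_mono) auto
  then have "0 < (x - 1) * (1 + 2*x - x^2)"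
    using assms(1) by (intro mult_pos_pos) (auto simp: power2_eq_square algebra_simps)
  then have \<epsilon>: "0 < \<epsilon>"
    by (simp add: \<epsilon>_def bulk_def algebra_simps eval_nat_numeral)
  have step: "\<rho> (Suc k) \<le> \<rho> k - \<epsilon>" for k
  proof -
    have "\<rho> (Suc k) = bulk x - x^4 / \<rho> k"
      using pos[of k] pos[of "Suc k"] by (simp add: \<rho>_def poly_strip_poly field_simps)
    \<comment> \<open>Arithmetic and geometric mean of \<open>\<rho> k\<close> and
      \<open>x^4 / \<rho> k\<close>.\<close>
    moreover have "2 * x^2 \<le> \<rho> k + x^4 / \<rho> k"
    proof -
      have "0 \<le> (\<rho> k - x^2)^2 / \<rho> k" using \<rho>[of k] by simp
      also have "\<dots> = \<rho> k + x^4 / \<rho> k - 2 * x^2"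
        using \<rho>[of k] by (simp add: field_simps eval_nat_numeral)
      finally show ?thesis by simp
    qed
    ultimately show ?thesis by (simp add: \<epsilon>_def)
  qed
  have "\<rho> k \<le> \<rho> 0 - real k * \<epsilon>" for k
  proof (induction k)
    case (Suc k)
    then show ?case using step[of k] by (simp add: algebra_simps)
  qed simp
  moreover obtain k where "\<rho> 0 < real k * \<epsilon>"
    using reals_Archimedean3[OF \<epsilon>] by blast
  ultimately show False using \<rho>[of k] by (smt (verit))
qed

text \<open>A point strictly between a smaller limit and \<open>1 + sqrt 2\<close> would exceed
  every \<open>r k\<close>, making all the polynomials positive there.\<close>

lemma dominant_roots_tendsto:
  assumes r: "\<And>k. dominant_root k (r k)" and "strict_mono r"
  shows "r \<longlonglongrightarrow> 1 + sqrt 2"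
proof -
  have lt: "r k < 1 + sqrt 2" for k
    using r[of k] strip_poly_pos_beyond_silver_ratio[of "r k" k] by (force simp: dominant_root_def)
  have "r 0 = 1" using dominant_root_unique[OF r dominant_root_0] .
  have inc: "incseq r" using assms(2) by (rule strict_mono_mono)
  then obtain L where L: "r \<longlonglongrightarrow> L" "\<And>k. r k \<le> L"
    using incseq_convergent[of r "1 + sqrt 2"] lt less_imp_le by metis
  have "L \<le> 1 + sqrt 2" using lt by (intro LIMSEQ_le_const2[OF L(1)]) (auto intro: less_imp_le)
  moreover have "\<not> L < 1 + sqrt 2"
  proof
    assume "L < 1 + sqrt 2"
    then obtain x where x: "L < x" "x < 1 + sqrt 2" using dense by blast
    then have "1 < x" using L(2)[of 0] \<open>r 0 = 1\<close> by simp
    then obtain k where "poly (strip_poly k) x \<le> 0"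
      using strip_poly_not_always_pos x(2) by blast
    moreover have "r k < x" using L(2)[of k] x(1) by simp
    ultimately show False using r[of k] by (force simp: dominant_root_def)
  qed
  ultimately show ?thesis using L(1) by simp
qed

section \<open>The transfer matrix of the strip\<close>


text \<open>
  An eigenvector with entries \<open>e h\<close> at (East, \<open>h\<close>) satisfies \<open>x * e h = (\<Sum>j. e j / x ^ \<bar>h - j\<bar>)\<close>. The inverse of
  the matrix of the \<open>x powi (- \<bar>h - j\<bar>)\<close> is tridiagonal, which gives this recurrence and, from the
  first row, its initial condition.
\<close>

fun height_profile :: "real \<Rightarrow> nat \<Rightarrow> real" where
  "height_profile x 0 = 1"
| "height_profile x (Suc 0) = (bulk x - x) / x^2"
| "height_profile x (Suc (Suc h)) = bulk x / x^2 * height_profile x (Suc h) - height_profile x h"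

lemma height_profile_step:
  assumes "x \<noteq> 0"
  shows "x^2 * height_profile x (Suc (Suc h))
    = bulk x * height_profile x (Suc h) - x^2 * height_profile x h"
  using assms by (simp add: right_diff_distrib)

lemma height_profile_1:
  assumes "x \<noteq> 0"
  shows "x^2 * height_profile x (Suc 0) = bulk x - x"
  using assms by simp

declare height_profile.simps(2,3) [simp del]

text \<open>For \<open>x > 1\<close> a root of \<open>strip_poly m\<close> thus means
  \<open>x * height_profile x (Suc m) = height_profile x m\<close>, the upper boundary condition.
  The factor \<open>x^(2*m)\<close> rescales one recurrence to the other.\<close>

lemma strip_poly_eq_height_profile:
  assumes "x \<noteq> 0"
  shows "(x^2 - 1) * poly (strip_poly m) x
    = x^(2*m) * (x^2 * height_profile x (Suc m) - x * height_profile x m)"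
proof (induction m rule: strip_poly.induct)
  case 1
  show ?case
    unfolding height_profile_1[OF assms]
    by (simp add: poly_strip_poly bulk_def algebra_simps eval_nat_numeral)
next
  case 2
  have "x^2 * (x^2 * height_profile x (Suc (Suc 0)) - x * height_profile x (Suc 0))
      = (bulk x - x) * (x^2 * height_profile x (Suc 0)) - x^4 * height_profile x 0"
    unfolding height_profile_step[OF assms] by (simp add: algebra_simps eval_nat_numeral)
  also have "\<dots> = (bulk x - x)^2 - x^4"
    unfolding height_profile_1[OF assms] by (simp add: power2_eq_square)
  also have "\<dots> = (x^2 - 1) * poly (strip_poly (Suc 0)) x"
    unfolding poly_strip_poly_1 bulk_def by algebra
  finally show ?case by simp
next
  case (3 k)
  define a b c where a_b_c_def: "a = height_profile x k" "b = height_profile x (Suc k)"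
    "c = height_profile x (Suc (Suc k))"
  have c: "x^2 * c = bulk x * b - x^2 * a"
    unfolding a_b_c_def by (rule height_profile_step[OF assms])
  have "(x^2 - 1) * poly (strip_poly (Suc (Suc k))) x
    = bulk x * ((x^2 - 1) * poly (strip_poly (Suc k)) x) - x^4 * ((x^2 - 1) * poly (strip_poly k) x)"
    by (simp add: poly_strip_poly algebra_simps)
  also have "\<dots> = x^(2*k) * x^2 * (bulk x * (x^2 * c - x * b) - x^2 * (x^2 * b - x * a))"
    unfolding 3 a_b_c_def by (simp add: algebra_simps eval_nat_numeral)
  \<comment> \<open>The second summand isolates the recurrence \<open>c\<close> and
    vanishes.\<close>
  also have "bulk x * (x^2 * c - x * b) - x^2 * (x^2 * b - x * a)
    = x^2 * (bulk x * c - x^2 * b - x * c) + x * (x^2 * c - (bulk x * b - x^2 * a))"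
    by (simp add: algebra_simps eval_nat_numeral)
  also have "\<dots> = x^2 * (bulk x * c - x^2 * b - x * c)"
    by (simp add: c)
  also have "bulk x * c - x^2 * b = x^2 * height_profile x (Suc (Suc (Suc k)))"
    unfolding a_b_c_def by (rule height_profile_step[OF assms, symmetric])
  finally show ?case
    unfolding a_b_c_def by (simp add: algebra_simps eval_nat_numeral)
qed

text \<open>Positivity of \<open>strip_poly h\<close> at \<open>x > 1\<close> means
  \<open>x * height_profile x (Suc h) > height_profile x h\<close>, so positivity climbs level by
  level.\<close>

lemma height_profile_pos:
  assumes "\<And>k. k < m \<Longrightarrow> 0 < poly (strip_poly k) x" "h \<le> m"
  shows "0 < height_profile x h"
  using assms(2)
proof (induction h)
  case (Suc h)
  have x: "1 < x" using assms(1)[of 0] Suc.prems by (simp add: poly_strip_poly)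
  have "0 < (x^2 - 1) * poly (strip_poly h) x"
    using x assms(1)[of h] Suc.prems by (simp add: one_less_power)
  then have "0 < x^2 * height_profile x (Suc h) - x * height_profile x h"
    using x by (subst (asm) strip_poly_eq_height_profile) (auto simp: zero_less_mult_iff)
  moreover have "0 < x * height_profile x h" using Suc x by simp
  ultimately have "0 < x^2 * height_profile x (Suc h)" by linarith
  then show ?case by (simp add: zero_less_mult_iff)
qed simp

text \<open>This is the sum of \<open>height_profile x j / x ^ (h - j)\<close> over
  \<open>j < h\<close>. For \<open>h > 0\<close> it is the eigenvector entry at (South,
  \<open>h - 1\<close>).\<close>

fun weight_below :: "real \<Rightarrow> nat \<Rightarrow> real" where
  "weight_below x 0 = 0"
| "weight_below x (Suc h) = (height_profile x h + weight_below x h) / x"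

text \<open>For \<open>h < m\<close> this is the eigenvector entry at (North,
  \<open>h + 1\<close>).\<close>

definition weight_above :: "nat \<Rightarrow> real \<Rightarrow> nat \<Rightarrow> real" where
  "weight_above m x h = (\<Sum>j\<in>{h<..m}. height_profile x j / x ^ (j - h))"

lemma weight_above_top [simp]: "weight_above m x m = 0"
  by (simp add: weight_above_def)

lemma weight_above_rec:
  assumes "h < m"
  shows "weight_above m x h = (height_profile x (Suc h) + weight_above m x (Suc h)) / x"
proof -
  have "{h<..m} = insert (Suc h) {Suc h<..m}" using assms by auto
  then have "weight_above m x h
      = height_profile x (Suc h) / x + (\<Sum>j\<in>{Suc h<..m}. height_profile x j / x ^ (j - h))"
    by (simp add: weight_above_def)
  also have "(\<Sum>j\<in>{Suc h<..m}. height_profile x j / x ^ (j - h)) = weight_above m x (Suc h) / x"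
    unfolding weight_above_def sum_divide_distrib
    by (rule sum.cong) (auto simp: Suc_diff_Suc[symmetric] dest: Suc_lessD)
  finally show ?thesis by (simp add: add_divide_distrib)
qed

text \<open>The base case is the initial condition of the profile; its three-term recurrence carries
  the formula upwards.\<close>

lemma weight_below_closed:
  assumes "x \<noteq> 0"
  shows "(x^2 - 1) * weight_below x h
    = x^2 * (x * height_profile x h - height_profile x (Suc h)) - (x^2 - 1) * height_profile x h"
proof (induction h)
  case 0
  show ?case
    unfolding right_diff_distrib height_profile_1[OF assms]
    by (simp add: bulk_def algebra_simps eval_nat_numeral)
next
  case (Suc h)
  have "x * weight_below x (Suc h) = height_profile x h + weight_below x h"
    using assms by simp
  then have "x * ((x^2 - 1) * weight_below x (Suc h))
      = (x^2 - 1) * height_profile x h + (x^2 - 1) * weight_below x h"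
    by (metis mult.left_commute distrib_left)
  also have "\<dots> = x * (x^2 * (x * height_profile x (Suc h) - height_profile x (Suc (Suc h)))
      - (x^2 - 1) * height_profile x (Suc h))
      + x * (x^2 * height_profile x (Suc (Suc h))
             - (bulk x * height_profile x (Suc h) - x^2 * height_profile x h))"
    unfolding Suc bulk_def by (simp add: algebra_simps eval_nat_numeral)
  also have "\<dots> = x * (x^2 * (x * height_profile x (Suc h) - height_profile x (Suc (Suc h)))
      - (x^2 - 1) * height_profile x (Suc h))"
    using height_profile_step[OF assms, of h] by simp
  finally show ?case using assms mult_left_cancel by blast
qed

text \<open>The induction descends from \<open>h = m\<close>, where the claim is the upper boundary
  condition.\<close>

lemma weight_above_closed:
  assumes "x \<noteq> 0" "x * height_profile x (Suc m) = height_profile x m" "h \<le> m"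
  shows "(x^2 - 1) * weight_above m x h = x * (x * height_profile x (Suc h) - height_profile x h)"
  using assms(3)
proof (induction rule: inc_induct)
  case base
  show ?case using assms(2) by simp
next
  case (step h)
  have "x * weight_above m x h = height_profile x (Suc h) + weight_above m x (Suc h)"
    using assms(1) by (simp add: weight_above_rec[OF step(2)])
  then have "x * ((x^2 - 1) * weight_above m x h)
      = (x^2 - 1) * height_profile x (Suc h) + (x^2 - 1) * weight_above m x (Suc h)"
    by (metis mult.left_commute distrib_left)
  also have "\<dots> = x * (x * (x * height_profile x (Suc h) - height_profile x h))
      + (x^2 * height_profile x (Suc (Suc h))
         - (bulk x * height_profile x (Suc h) - x^2 * height_profile x h))"
    unfolding step(3) bulk_def by (simp add: algebra_simps eval_nat_numeral)
  also have "\<dots> = x * (x * (x * height_profile x (Suc h) - height_profile x h))"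
    using height_profile_step[OF assms(1), of h] by simp
  finally show ?case using assms(1) mult_left_cancel by blast
qed

text \<open>This is the eigenvalue equation at (East, \<open>h\<close>) with the East successor
  moved to the left. In the sum of the closed forms the profile at \<open>Suc h\<close>
  cancels.\<close>

lemma height_profile_balance:
  assumes "1 \<le> x" "poly (strip_poly m) x = 0" "x = 1 \<Longrightarrow> m = 0" "h \<le> m"
  shows "(x - 1) * height_profile x h = weight_above m x h + weight_below x h"
proof (cases "x = 1")
  \<comment> \<open>Here the factor \<open>x^2 - 1\<close> of the closed forms is 0, but
    \<open>m = 0\<close> makes both weights 0.\<close>
  case True
  then show ?thesis using assms by simp
next
  case False
  then have x: "1 < x" using assms(1) by simp
  then have "x^2 * height_profile x (Suc m) - x * height_profile x m = 0"
    using strip_poly_eq_height_profile[of x m] assms(2) by simp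
  then have "x * (x * height_profile x (Suc m) - height_profile x m) = 0"
    by (simp add: power2_eq_square algebra_simps)
  then have boundary: "x * height_profile x (Suc m) = height_profile x m"
    using x by simp
  have "(x^2 - 1) * ((x - 1) * height_profile x h)
      = (x^2 - 1) * weight_above m x h + (x^2 - 1) * weight_below x h"
    using x assms(4) by (subst weight_above_closed[OF _ boundary], simp, simp, subst weight_below_closed)
      (simp_all add: algebra_simps eval_nat_numeral)
  then have "(x^2 - 1) * ((x - 1) * height_profile x h)
      = (x^2 - 1) * (weight_above m x h + weight_below x h)"
    by (simp only: distrib_left)
  moreover have "x^2 - 1 \<noteq> 0" using x by (simp add: power2_eq_1_iff)
  ultimately show ?thesis using mult_left_cancel by blast
qed

section \<open>Paths as words with a remembered last step and height\<close>

definition vertical :: "step \<Rightarrow> int" where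
  "vertical t = snd (step_vec t)"

lemma vertical_simps [simp]: "vertical North = 1" "vertical South = -1" "vertical East = 0"
  by (simp_all add: vertical_def)

definition admissible :: "step \<Rightarrow> step \<Rightarrow> bool" where
  "admissible s t \<longleftrightarrow> \<not> (s = North \<and> t = South) \<and> \<not> (s = South \<and> t = North)"

text \<open>\<open>s\<close> is the preceding step and \<open>h\<close> the current height. The
  starting height is not tested, hence the assumption of \<open>confined_iff\<close>.\<close>

fun confined :: "nat \<Rightarrow> step \<Rightarrow> int \<Rightarrow> step list \<Rightarrow> bool" where
  "confined m s h [] \<longleftrightarrow> True"
| "confined m s h (t # w) \<longleftrightarrow>
     admissible s t \<and> h + vertical t \<in> {0..int m} \<and> confined m t (h + vertical t) w"

lemma all_less_Cons:
  "(\<forall>i. Suc i < length (s # t # w) \<longrightarrow> P i) \<longleftrightarrow>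
    P 0 \<and> (\<forall>i. Suc i < length (t # w) \<longrightarrow> P (Suc i))"
  using All_less_Suc2[of "length w" P] by simp

lemma non_retracing_Cons_Cons:
  "non_retracing (s # t # w) \<longleftrightarrow> admissible s t \<and> non_retracing (t # w)"
  unfolding non_retracing_def admissible_def all_less_Cons by simp

text \<open>East can therefore stand for the missing step before a path begins.\<close>

lemma non_retracing_East_Cons: "non_retracing (East # w) \<longleftrightarrow> non_retracing w"
  by (cases w) (simp_all add: non_retracing_Cons_Cons admissible_def, simp add: non_retracing_def)

lemma path_vertex_0 [simp]: "path_vertex w 0 = 0"
  by (simp add: path_vertex_def)

lemma path_vertex_Cons_Suc [simp]: "path_vertex (t # w) (Suc k) = step_vec t + path_vertex w k"
  by (simp add: path_vertex_def)

text \<open>No step goes left, so staying in the strip is a condition on heights alone.\<close>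

lemma fst_path_vertex_nonneg: "0 \<le> fst (path_vertex w k)"
proof (induction w arbitrary: k)
  case (Cons t w)
  have "0 \<le> fst (step_vec t)" by (cases t) auto
  then show ?case using Cons by (cases k) auto
qed (simp add: path_vertex_def)

lemma confined_iff:
  assumes "h \<in> {0..int m}"
  shows "confined m s h w \<longleftrightarrow> non_retracing (s # w) \<and>
    (\<forall>k\<le>length w. h + snd (path_vertex w k) \<in> {0..int m})"
  using assms
proof (induction w arbitrary: s h)
  case Nil
  then show ?case by (simp add: non_retracing_def)
next
  case (Cons t w)
  have split: "(\<forall>k\<le>length (t # w). h + snd (path_vertex (t # w) k) \<in> {0..int m}) \<longleftrightarrow>
      (\<forall>k\<le>length w. h + vertical t + snd (path_vertex w k) \<in> {0..int m})"
    using All_less_Suc2[of "Suc (length w)" "\<lambda>k. h + snd (path_vertex (t # w) k) \<in> {0..int m}"]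
      Cons.prems
    by (simp add: less_Suc_eq_le vertical_def add.assoc del: atLeastAtMost_iff)
  show ?case
  proof (cases "h + vertical t \<in> {0..int m}")
    case True
    then show ?thesis
      unfolding split confined.simps non_retracing_Cons_Cons Cons.IH[OF True] by blast
  next
    case False
    then show ?thesis
      unfolding split by (auto intro!: exI[of _ 0])
  qed
qed

lemma monotone_paths_eq_confined:
  "monotone_paths m n = {w. length w = n \<and> confined m East 0 w}"
  using fst_path_vertex_nonneg
  by (auto simp: monotone_paths_def confined_iff non_retracing_East_Cons strip_def mem_Times_iff
      split_beta)

section \<open>Counting paths by a walk on states\<close>

definition successors :: "nat \<Rightarrow> step \<times> int \<Rightarrow> (step \<times> int) set" where
  "successors m i = {(t, h). admissible (fst i) t \<and> h = snd i + vertical t \<and> h \<in> {0..int m}}"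

definition num_continuations :: "nat \<Rightarrow> nat \<Rightarrow> step \<times> int \<Rightarrow> nat" where
  "num_continuations m n i = card {w. length w = n \<and> confined m (fst i) (snd i) w}"

lemma UNIV_step: "UNIV = {North, South, East}"
  using step.exhaust by auto

lemma finite_steps: "finite (T :: step set)"
  by (rule finite_subset[OF subset_UNIV]) (simp add: UNIV_step)

lemma successors_eq_image:
  "successors m (s, h)
    = (\<lambda>t. (t, h + vertical t)) ` {t. admissible s t \<and> h + vertical t \<in> {0..int m}}"
  by (auto simp: successors_def)

lemma sum_successors:
  fixes F :: "step \<times> int \<Rightarrow> 'b::comm_monoid_add"
  shows "sum F (successors m (s, h))
    = (\<Sum>t\<in>{t. admissible s t \<and> h + vertical t \<in> {0..int m}}. F (t, h + vertical t))"
  unfolding successors_eq_image by (subst sum.reindex) (auto simp: inj_on_def)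

lemma num_continuations_0: "num_continuations m 0 i = 1"
proof -
  have "{w. length w = 0 \<and> confined m (fst i) (snd i) w} = {[]}" by auto
  then show ?thesis by (simp add: num_continuations_def)
qed

lemma num_continuations_Suc:
  "num_continuations m (Suc n) i = (\<Sum>j\<in>successors m i. num_continuations m n j)"
proof -
  obtain s h where i: "i = (s, h)" by fastforce
  define T where "T = {t. admissible s t \<and> h + vertical t \<in> {0..int m}}"
  define W where "W t = {w. length w = n \<and> confined m t (h + vertical t) w}" for t
  have fin: "finite (W t)" for t
  proof -
    have "finite {w :: step list. set w \<subseteq> UNIV \<and> length w = n}"
      by (rule finite_lists_length_eq[OF finite_steps])
    then show ?thesis by (rule rev_finite_subset) (auto simp: W_def)
  qed
  have "{w. length w = Suc n \<and> confined m s h w} = (\<Union>t\<in>T. (#) t ` W t)"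
    by (auto simp: T_def W_def length_Suc_conv image_iff)
  then have "num_continuations m (Suc n) i = card (\<Union>t\<in>T. (#) t ` W t)"
    by (simp add: num_continuations_def i)
  also have "\<dots> = (\<Sum>t\<in>T. card ((#) t ` W t))"
    by (rule card_UN_disjoint) (auto simp: fin finite_steps)
  also have "\<dots> = (\<Sum>t\<in>T. num_continuations m n (t, h + vertical t))"
    by (simp add: card_image num_continuations_def W_def)
  finally show ?thesis by (simp add: i sum_successors T_def)
qed

text \<open>The states (North, 0) and (South, \<open>m\<close>) cannot be reached; keeping them makes
  the state space a product.\<close>

definition states :: "nat \<Rightarrow> (step \<times> int) set" where
  "states m = UNIV \<times> {0..int m}"

text \<open>An East step is always allowed; then South and East alternate down to height 0, so the
  induction visits only East states.\<close>

lemma successors_reach_start: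
  assumes "i \<in> states m"
  shows "(i, (East, 0)) \<in> {(i, j). i \<in> states m \<and> j \<in> successors m i}\<^sup>*" (is "_ \<in> ?R\<^sup>*")
proof -
  have East: "((East, int k), (East, 0)) \<in> ?R\<^sup>*" if "k \<le> m" for k
    using that
  proof (induction k)
    case (Suc k)
    have steps: "((East, int (Suc k)), (South, int k)) \<in> ?R" "((South, int k), (East, int k)) \<in> ?R"
      using Suc.prems by (auto simp: states_def successors_def admissible_def)
    have "((East, int k), (East, 0)) \<in> ?R\<^sup>*" using Suc by simp
    with steps(2) have "((South, int k), (East, 0)) \<in> ?R\<^sup>*"
      by (rule converse_rtrancl_into_rtrancl)
    with steps(1) show ?case by (rule converse_rtrancl_into_rtrancl)
  qed simp
  obtain s h where i: "i = (s, h)" "0 \<le> h" "h \<le> int m" using assms by (auto simp: states_def)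
  then have "(i, (East, h)) \<in> ?R"
    by (auto simp: states_def successors_def admissible_def)
  moreover have "((East, h), (East, 0)) \<in> ?R\<^sup>*" using East[of "nat h"] i by simp
  ultimately show ?thesis by (rule converse_rtrancl_into_rtrancl)
qed

text \<open>The North and South entries are solved from their own eigenvalue equations, whose
  successors are East at the same height and the same vertical step again. Only the equation at East
  is left to check.\<close>

fun eigenvector :: "nat \<Rightarrow> real \<Rightarrow> step \<times> int \<Rightarrow> real" where
  "eigenvector m x (East, h) = height_profile x (nat h)"
| "eigenvector m x (North, h) = (height_profile x (nat h) + weight_above m x (nat h)) / x"
| "eigenvector m x (South, h) = (height_profile x (nat h) + weight_below x (nat h)) / x"

lemma eigenvector_pos:
  assumes "\<And>k. k < m \<Longrightarrow> 0 < poly (strip_poly k) x" "0 < x" "i \<in> states m"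
  shows "0 < eigenvector m x i"
proof -
  have hp: "0 < height_profile x h" if "h \<le> m" for h
    using height_profile_pos[OF assms(1) that] .
  have "0 \<le> weight_below x h" if "h \<le> m" for h
    using that
  proof (induction h)
    case (Suc h)
    then show ?case using hp[of h] assms(2) by simp
  qed simp
  moreover have "0 \<le> weight_above m x h" for h
    unfolding weight_above_def using hp assms(2) by (auto intro!: sum_nonneg simp: less_imp_le)
  moreover obtain s h where "i = (s, h)" "nat h \<le> m" using assms(3) by (auto simp: states_def)
  ultimately show ?thesis
    using hp[of "nat h"] assms(2) by (cases s) (auto intro!: divide_pos_pos add_pos_nonneg)
qed

lemma sum_eigenvector_successors:
  assumes "1 \<le> x" "poly (strip_poly m) x = 0" "x = 1 \<Longrightarrow> m = 0" "i \<in> states m"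
  shows "(\<Sum>j\<in>successors m i. eigenvector m x j) = x * eigenvector m x i"
proof -
  obtain s k where i: "i = (s, int k)" and k: "k \<le> m"
    using assms(4) by (auto simp: states_def) (metis nat_0_le nat_le_iff)
  \<comment> \<open>The value 0 for forbidden steps lets the sum run over all three steps.\<close>
  define contrib where "contrib t = (if admissible s t \<and> int k + vertical t \<in> {0..int m}
      then eigenvector m x (t, int k + vertical t) else 0)" for t
  have "(\<Sum>j\<in>successors m i. eigenvector m x j) = sum contrib UNIV"
    unfolding i sum_successors
    by (rule sum.mono_neutral_cong_left) (auto simp: contrib_def finite_steps)
  also have "\<dots> = contrib East + contrib North + contrib South"
    by (simp add: UNIV_step)
  also have "contrib East = height_profile x k"
    using k by (simp add: contrib_def admissible_def)
  \<comment> \<open>The weights vanish at the top and at the bottom respectively, matching the steps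
    that would leave the strip.\<close>
  also have "contrib North = (if s = South then 0 else weight_above m x k)"
  proof (cases "k = m")
    case False
    moreover have "nat (int k + 1) = Suc k" by simp
    ultimately show ?thesis
      using k weight_above_rec[of k m x] by (auto simp: contrib_def admissible_def)
  qed (simp add: contrib_def)
  also have "contrib South = (if s = North then 0 else weight_below x k)"
    using k by (cases k) (auto simp: contrib_def admissible_def)
  finally show ?thesis
    using height_profile_balance[OF assms(1-3) k] assms(1)
    by (cases s) (simp_all add: i left_diff_distrib)
qed

section \<open>Growth of the path counts\<close>

lemma num_paths_asymptotics:
  assumes r: "1 \<le> r" "poly (strip_poly m) r = 0" "\<And>k. k < m \<Longrightarrow> 0 < poly (strip_poly k) r"
  shows "\<exists>q>0. (\<lambda>n. real (num_paths m n) / r ^ n) \<longlonglongrightarrow> q"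
proof -
  \<comment> \<open>For \<open>m > 0\<close>, positivity of \<open>strip_poly 0\<close> at
    \<open>r\<close> says \<open>1 < r\<close>.\<close>
  have r1: "m = 0" if "r = 1" using r(3)[of 0] that by (auto simp: poly_strip_poly)
  have start: "(East, 0) \<in> states m" by (simp add: states_def)
  have "\<exists>L>0. \<forall>i\<in>states m.
      (\<lambda>n. real (num_continuations m n i) / r ^ n) \<longlonglongrightarrow> L * eigenvector m r i"
  proof (rule walk_count_asymptotics[OF _ _ _ _ _ _ _ start _ successors_reach_start])
    show "finite (states m)" by (simp add: states_def finite_steps)
    show "successors m i \<subseteq> states m" for i by (auto simp: states_def successors_def)
    show "0 < eigenvector m r i" if "i \<in> states m" for i
      using eigenvector_pos[OF r(3) _ that] r(1) by simp
    show "(\<Sum>j\<in>successors m i. eigenvector m r j) = r * eigenvector m r i"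
      if "i \<in> states m" for i
      using sum_eigenvector_successors[OF r(1,2) r1 that] .
    show "(East, 0) \<in> successors m (East, 0)" by (simp add: successors_def admissible_def)
  qed (use r(1) in \<open>auto simp: num_continuations_0 num_continuations_Suc\<close>)
  \<comment> \<open>The eigenvector entry at (East, 0) is
    \<open>height_profile r 0 = 1\<close>.\<close>
  then obtain L where "0 < L" "(\<lambda>n. real (num_continuations m n (East, 0)) / r ^ n) \<longlonglongrightarrow> L"
    using start by fastforce
  moreover have "num_continuations m n (East, 0) = num_paths m n" for n
    by (simp add: num_continuations_def num_paths_def monotone_paths_eq_confined)
  ultimately show ?thesis by auto
qed

theorem theorem1p1:
  "\<exists>(q :: nat \<Rightarrow> real) (r :: nat \<Rightarrow> real).
     (\<forall>m. (\<lambda>n. real (num_paths m n) / (q m * r m ^ n)) \<longlonglongrightarrow> 1) \<and>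
     r 0 = 1 \<and> strict_mono r \<and>
     r \<longlonglongrightarrow> 1 + sqrt 2 \<and>
     (\<forall>m. is_largest_real_root (a_poly m) (r m))"
proof -
  obtain r where r: "\<And>k. dominant_root k (r k)"
    using dominant_roots_increasing by metis
  have r_0: "r 0 = 1" by (rule dominant_root_unique[OF r dominant_root_0])
  have "r k < r (Suc k)" for k
    using dominant_roots_increasing[of k] dominant_root_unique r by metis
  then have mono: "strict_mono r" by (simp add: strict_mono_Suc_iff)
  have "\<exists>q>0. (\<lambda>n. real (num_paths m n) / r m ^ n) \<longlonglongrightarrow> q" for m
  proof (rule num_paths_asymptotics)
    show "1 \<le> r m" using strict_mono_less_eq[OF mono, of 0 m] r_0 by simp
    show "poly (strip_poly m) (r m) = 0" using r by (simp add: dominant_root_def)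
    \<comment> \<open>\<open>r m\<close> lies beyond the dominant root of each earlier
      polynomial.\<close>
    show "0 < poly (strip_poly k) (r m)" if "k < m" for k
      using r[of k] strict_monoD[OF mono that] by (simp add: dominant_root_def)
  qed
  then obtain q where q: "\<And>m. 0 < q m" "\<And>m. (\<lambda>n. real (num_paths m n) / r m ^ n) \<longlonglongrightarrow> q m"
    by metis
  have "(\<lambda>n. real (num_paths m n) / (q m * r m ^ n)) \<longlonglongrightarrow> 1" for m
    using tendsto_divide[OF q(2)[of m] tendsto_const[of "q m"]] q(1)[of m] by (simp add: mult.commute)
  then show ?thesis
    using r_0 mono dominant_roots_tendsto[OF r mono] is_largest_real_root_a_poly[OF r] by blast
qed

end
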